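(* Let $R$ be a commutative ring with unity. Let $C$ be an edge-labeled cycle on $n$ vertices $v_1,\dots,v_n$, let $1\le i<j\le n$, and let $T_i$ and $T_j$ be edge-labeled trees (over $R$). Let $G_1$ be the graph formed by pasting $T_i$ to $C$ at the vertex $v_i$ (so $V(T_i)\cap V(C)=\{v_i\}$), and let $G_2$ be the graph formed by pasting $T_j$ to $G_1$ at the vertex $v_j$ (so $V(T_j)\cap V(G_1)=\{v_j\}$). Let $\alpha$ be the edge-labeling of $G_2$ giving each edge the label it has in $C$, $T_i$, or $T_j$. Consider the conditions: (i) for every $u\in V(C)$ and $w\in V(T_i)$, $$\bigcap_{P\in\mathcal{P}_{G_1}(u,w)}\alpha(P)=\Big(\bigcap_{P\in\mathcal{P}_C(u,v_i)}\alpha(P)\Big)+\Big(\bigcap_{P\in\mathcal{P}_{T_i}(v_i,w)}\alpha(P)\Big);$$ (ii) for every $r\in V(G_1)$ and $s\in V(T_j)$, $$\bigcap_{P\in\mathcal{P}_{G_2}(r,s)}\alpha(P)=\Big(\bigcap_{P\in\mathcal{P}_{G_1}(r,v_j)}\alpha(P)\Big)+\Big(\bigcap_{P\in\mathcal{P}_{T_j}(v_j,s)}\alpha(P)\Big).$$ Then both (i) and (ii) hold if and only if $(G_2,\alpha)$ satisfies the Universal Difference Property.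
   Context: An edge-labeling of a graph over $R$ assigns to each edge an ideal of $R$. A spline on $(G,\alpha)$ is a function $\rho:V(G)\to R$ with $\rho(u)-\rho(v)\in\alpha(uv)$ for every edge $uv$. A path has no repeated vertices; $\mathcal{P}_H(u,v)$ is the set of all paths in the graph $H$ from $u$ to $v$, and $\alpha(P)$ is the sum of the ideals labeling the edges of $P$. Pasting two graphs at a vertex $z$ means taking their union where they share only the vertex $z$. $(G,\alpha)$ satisfies the Universal Difference Property (UDP) if for every pair of vertices $u,w$ and every $x\in\bigcap_{P\in\mathcal{P}_G(u,w)}\alpha(P)$ there is a spline $\rho$ on $(G,\alpha)$ with $\rho(u)-\rho(w)=x$. *)

theory Defs
  imports "HOL-Algebra.Ideal"
begin

text \<open>Simple undirected graphs: edges are two-element sets of vertices.  Finiteness is not required.\<close>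

record 'v ugraph =
  verts :: "'v set"
  edges :: "'v set set"

definition simple_graph :: "'v ugraph \<Rightarrow> bool" where
  "simple_graph G \<longleftrightarrow>
     (\<forall>e \<in> edges G. \<exists>u \<in> verts G. \<exists>v \<in> verts G. u \<noteq> v \<and> e = {u, v})"

definition subgraph :: "'v ugraph \<Rightarrow> 'v ugraph \<Rightarrow> bool" where
  "subgraph H G \<longleftrightarrow> verts H \<subseteq> verts G \<and> edges H \<subseteq> edges G"

definition graph_union :: "'v ugraph \<Rightarrow> 'v ugraph \<Rightarrow> 'v ugraph" where
  "graph_union G H = \<lparr>verts = verts G \<union> verts H, edges = edges G \<union> edges H\<rparr>"

definition pasting :: "'v ugraph \<Rightarrow> 'v ugraph \<Rightarrow> 'v \<Rightarrow> 'v ugraph \<Rightarrow> bool" where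
  "pasting G H z K \<longleftrightarrow> verts H \<inter> verts G = {z} \<and> K = graph_union G H"

text \<open>Paths are represented by their vertex lists; \<open>[u]\<close> is the trivial path from \<open>u\<close> to \<open>u\<close>.\<close>

definition path_edges :: "'v list \<Rightarrow> 'v set list" where
  "path_edges p = map2 (\<lambda>x y. {x, y}) p (tl p)"

definition paths :: "'v ugraph \<Rightarrow> 'v \<Rightarrow> 'v \<Rightarrow> 'v list set" where
  "paths G u w = {p. p \<noteq> [] \<and> hd p = u \<and> last p = w \<and> distinct p \<and>
     set p \<subseteq> verts G \<and> set (path_edges p) \<subseteq> edges G}"

definition connected_graph :: "'v ugraph \<Rightarrow> bool" where
  "connected_graph G \<longleftrightarrow>
     verts G \<noteq> {} \<and> (\<forall>u \<in> verts G. \<forall>w \<in> verts G. paths G u w \<noteq> {})"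

definition cycle_graph :: "'v ugraph \<Rightarrow> nat \<Rightarrow> (nat \<Rightarrow> 'v) \<Rightarrow> bool" where
  "cycle_graph C n v \<longleftrightarrow> n \<ge> 3 \<and> inj_on v {1..n} \<and> verts C = v ` {1..n} \<and>
     edges C = {{v k, v (k + 1)} | k. 1 \<le> k \<and> k < n} \<union> {{v n, v 1}}"

definition tree_graph :: "'v ugraph \<Rightarrow> bool" where
  "tree_graph T \<longleftrightarrow> simple_graph T \<and> connected_graph T \<and>
     \<not> (\<exists>H n v. subgraph H T \<and> cycle_graph H n v)"

definition edge_labeling ::
    "('a, 'b) ring_scheme \<Rightarrow> 'v ugraph \<Rightarrow> ('v set \<Rightarrow> 'a set) \<Rightarrow> bool" where
  "edge_labeling R G \<alpha> \<longleftrightarrow> (\<forall>e \<in> edges G. ideal (\<alpha> e) R)"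

text \<open>The empty sum, for the trivial path, is the zero ideal.\<close>

definition path_ideal ::
    "('a, 'b) ring_scheme \<Rightarrow> ('v set \<Rightarrow> 'a set) \<Rightarrow> 'v list \<Rightarrow> 'a set" where
  "path_ideal R \<alpha> p = foldr (\<lambda>e I. \<alpha> e <+>\<^bsub>R\<^esub> I) (path_edges p) {\<zero>\<^bsub>R\<^esub>}"

text \<open>The intersection is taken among subsets of the ring, so an empty family yields the unit ideal.\<close>

definition paths_inter ::
    "('a, 'b) ring_scheme \<Rightarrow> ('v set \<Rightarrow> 'a set) \<Rightarrow> 'v ugraph \<Rightarrow> 'v \<Rightarrow> 'v \<Rightarrow> 'a set" where
  "paths_inter R \<alpha> G u w = carrier R \<inter> (\<Inter>p \<in> paths G u w. path_ideal R \<alpha> p)"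

definition spline ::
    "('a, 'b) ring_scheme \<Rightarrow> 'v ugraph \<Rightarrow> ('v set \<Rightarrow> 'a set) \<Rightarrow> ('v \<Rightarrow> 'a) \<Rightarrow> bool" where
  "spline R G \<alpha> \<rho> \<longleftrightarrow> \<rho> \<in> verts G \<rightarrow> carrier R \<and>
     (\<forall>u v. {u, v} \<in> edges G \<longrightarrow> \<rho> u \<ominus>\<^bsub>R\<^esub> \<rho> v \<in> \<alpha> {u, v})"

definition UDP ::
    "('a, 'b) ring_scheme \<Rightarrow> 'v ugraph \<Rightarrow> ('v set \<Rightarrow> 'a set) \<Rightarrow> bool" where
  "UDP R G \<alpha> \<longleftrightarrow>
     (\<forall>u \<in> verts G. \<forall>w \<in> verts G. \<forall>x \<in> paths_inter R \<alpha> G u w.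
        \<exists>\<rho>. spline R G \<alpha> \<rho> \<and> \<rho> u \<ominus>\<^bsub>R\<^esub> \<rho> w = x)"

end

theory Submission
  imports Defs
begin

text \<open>If \<open>K\<close> is obtained by pasting \<open>G\<close> and \<open>H\<close> at \<open>z\<close>, then every path of \<open>K\<close> between two
  vertices of \<open>G\<close> stays in \<open>G\<close>, and every path from \<open>G\<close> to \<open>H\<close> passes through \<open>z\<close>. Splines of
  \<open>K\<close> restrict to \<open>G\<close> and \<open>H\<close>, and conversely splines on \<open>G\<close> and \<open>H\<close> can be glued after adding
  a constant to one of them. Hence the UDP of \<open>K\<close> passes to \<open>G\<close>, and if \<open>G\<close> and \<open>H\<close> have the UDP,
  then the UDP of \<open>K\<close> amounts to the formula for the intersections of path ideals.
  It remains to see that trees and cycles have the UDP. In a tree every edge \<open>e\<close> of the path from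
  \<open>u\<close> to \<open>w\<close> separates \<open>u\<close> from \<open>w\<close>, so an element of \<open>\<alpha> e\<close> is realised by a spline that is constant
  on the two sides of \<open>e\<close>; sums of these realise the path ideal. In a cycle, partial sums along
  the two arcs from \<open>u\<close> to \<open>w\<close> give splines on the arcs that agree at \<open>u\<close> and \<open>w\<close>.\<close>

section \<open>Vertex lists and path edges\<close>

lemma path_edges_Nil [simp]: "path_edges [] = []"
  by (simp add: path_edges_def)

lemma path_edges_singleton [simp]: "path_edges [a] = []"
  by (simp add: path_edges_def)

lemma path_edges_Cons2 [simp]: "path_edges (a # b # p) = {a, b} # path_edges (b # p)"
  by (simp add: path_edges_def)

text \<open>Keeping the cut vertex \<open>z\<close> in both pieces loses no edge and counts none
  twice. Paths are cut in this form throughout.\<close>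

lemma path_edges_append: "path_edges (p @ z # q) = path_edges (p @ [z]) @ path_edges (z # q)"
proof (induction p)
  case (Cons a p)
  then show ?case by (cases p) auto
qed simp

lemma path_edges_rev: "path_edges (rev p) = rev (path_edges p)"
proof (induction p rule: induct_list012)
  case (3 a b p)
  have "path_edges (rev (a # b # p)) = path_edges (rev p @ b # [a])" by simp
  also have "\<dots> = path_edges (rev (b # p)) @ [{b, a}]"
    by (subst path_edges_append) simp
  finally show ?case using 3 by (simp add: insert_commute)
qed simp_all

lemma path_edges_subset: "e \<in> set (path_edges p) \<Longrightarrow> e \<subseteq> set p"
  by (induction p rule: induct_list012) auto

lemma path_edges_nth: "length (path_edges p) = length p - 1"
    "k + 1 < length p \<Longrightarrow> path_edges p ! k = {p ! k, p ! (k + 1)}"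
  by (simp_all add: path_edges_def nth_tl)

text \<open>Index form of the edge set, for comparison with the numbered edges in
  \<open>cycle_graph\<close>.\<close>

lemma set_path_edges: "set (path_edges p) = {{p ! k, p ! (k + 1)} | k. k + 1 < length p}"
proof -
  have "set (path_edges p) = {path_edges p ! k | k. k + 1 < length p}"
    unfolding set_conv_nth path_edges_nth(1) less_diff_conv ..
  also have "\<dots> = {{p ! k, p ! (k + 1)} | k. k + 1 < length p}"
    by (intro Collect_cong ex_cong1) (auto simp: path_edges_nth(2) simp del: add_Suc_right Suc_eq_plus1)
  finally show ?thesis .
qed

lemma paths_rev: "p \<in> paths G u w \<Longrightarrow> rev p \<in> paths G w u"
  by (simp add: paths_def path_edges_rev hd_rev last_rev)

lemma simple_graph_edgeD:
  assumes "simple_graph G" "{a, b} \<in> edges G"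
  shows "a \<in> verts G" "b \<in> verts G" "a \<noteq> b"
proof -
  obtain c d where "c \<in> verts G" "d \<in> verts G" "c \<noteq> d" "{a, b} = {c, d}"
    using assms unfolding simple_graph_def by blast
  then show "a \<in> verts G" "b \<in> verts G" "a \<noteq> b" by (auto simp: doubleton_eq_iff)
qed

section \<open>Pasting two graphs at a vertex\<close>

lemma pasting_commute: "pasting G H z K \<longleftrightarrow> pasting H G z K"
  unfolding pasting_def graph_union_def by (metis Int_commute Un_commute)

lemma pasting_simple_graph:
  assumes "pasting G H z K" "simple_graph G" "simple_graph H"
  shows "simple_graph K"
proof -
  have K: "verts K = verts G \<union> verts H" "edges K = edges G \<union> edges H"
    using assms(1) by (simp_all add: pasting_def graph_union_def)
  show ?thesis
    unfolding simple_graph_def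
  proof
    fix e assume "e \<in> edges K"
    then have "(\<exists>u\<in>verts G. \<exists>v\<in>verts G. u \<noteq> v \<and> e = {u, v}) \<or>
        (\<exists>u\<in>verts H. \<exists>v\<in>verts H. u \<noteq> v \<and> e = {u, v})"
      using assms(2,3) unfolding simple_graph_def K by blast
    then show "\<exists>u\<in>verts K. \<exists>v\<in>verts K. u \<noteq> v \<and> e = {u, v}" unfolding K by auto
  qed
qed

text \<open>The first edge outside \<open>G\<close> would be an edge of \<open>H\<close> leaving a
  vertex of \<open>G\<close>, and that vertex could only be \<open>z\<close>. Excluding
  \<open>z\<close> from \<open>butlast p\<close> alone still allows the walk to end at
  \<open>z\<close>.\<close>

lemma walk_stays_in_part:
  assumes "pasting G H z K" "simple_graph G" "simple_graph H"
    and "p \<noteq> []" "hd p \<in> verts G" "z \<notin> set (butlast p)" "set (path_edges p) \<subseteq> edges K"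
  shows "set p \<subseteq> verts G \<and> set (path_edges p) \<subseteq> edges G"
  using assms(4-)
proof (induction p rule: induct_list012)
  case (3 a b p)
  have ab: "{a, b} \<in> edges G"
  proof (rule ccontr)
    assume "{a, b} \<notin> edges G"
    then have "{a, b} \<in> edges H"
      using 3 assms(1) by (auto simp: pasting_def graph_union_def)
    then have "a \<in> verts H" using simple_graph_edgeD assms(3) by metis
    then have "a = z" using 3 assms(1) by (auto simp: pasting_def)
    then show False using 3 by simp
  qed
  moreover have "b \<in> verts G" using simple_graph_edgeD[OF assms(2) ab] by simp
  ultimately show ?case using 3 by auto
qed auto

text \<open>Cutting a path at \<open>z\<close> leaves two walks that meet \<open>z\<close> only at an end (the second one
  read backwards), so each of them stays in the part where it starts.\<close>

lemma path_split_at_paste_vertex: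
  assumes K: "pasting G H z K" "simple_graph G" "simple_graph H"
    and A: "A = G \<or> A = H" and B: "B = G \<or> B = H"
    and p: "q @ z # r \<in> paths K u w" and u: "u \<in> verts A" and w: "w \<in> verts B"
  shows "q @ [z] \<in> paths A u z" "z # r \<in> paths B z w"
proof -
  \<comment> \<open>Pasting is symmetric in \<open>G\<close> and \<open>H\<close>, so
    \<open>walk_stays_in_part\<close> serves for a walk that starts in either part.\<close>
  have part: "set l \<subseteq> verts X \<and> set (path_edges l) \<subseteq> edges X"
    if "X = G \<or> X = H" "l \<noteq> []" "hd l \<in> verts X" "z \<notin> set (butlast l)"
      "set (path_edges l) \<subseteq> edges K" for X l
    using that walk_stays_in_part[OF K] K
      walk_stays_in_part[of H G z K] pasting_commute[of G H] by blast
  have p': "hd (q @ z # r) = u" "last (z # r) = w" "distinct (q @ z # r)"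
      "set (path_edges (q @ [z])) \<subseteq> edges K" "set (path_edges (z # r)) \<subseteq> edges K"
    using p by (auto simp: paths_def path_edges_append[of q z r])
  have hd: "hd (q @ [z]) = u" using p'(1) by (cases q) auto
  have "set (q @ [z]) \<subseteq> verts A \<and> set (path_edges (q @ [z])) \<subseteq> edges A"
    using p' hd u by (intro part A) auto
  then show "q @ [z] \<in> paths A u z"
    using p' hd by (auto simp: paths_def)
  have "set (rev (z # r)) \<subseteq> verts B \<and> set (path_edges (rev (z # r))) \<subseteq> edges B"
  proof (rule part[OF B])
    show "hd (rev (z # r)) \<in> verts B" using p'(2) w by (simp only: hd_rev)
    show "set (path_edges (rev (z # r))) \<subseteq> edges K" using p'(5) by (simp only: path_edges_rev set_rev)
  qed (use p'(3) in auto)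
  then show "z # r \<in> paths B z w"
    using p' by (auto simp: paths_def path_edges_rev simp del: rev.simps)
qed

text \<open>A path that left \<open>G\<close> and came back would have to pass \<open>z\<close>
  twice. A path through \<open>z\<close> therefore splits into two paths of \<open>G\<close>, and a
  path avoiding \<open>z\<close> never leaves \<open>G\<close>.\<close>

lemma paths_pasting_same_part:
  assumes K: "pasting G H z K" "simple_graph G" "simple_graph H"
    and "u \<in> verts G" "w \<in> verts G"
  shows "paths K u w = paths G u w"
proof
  show "paths G u w \<subseteq> paths K u w"
    using K(1) by (auto simp: paths_def pasting_def graph_union_def)
  show "paths K u w \<subseteq> paths G u w"
  proof
    fix p assume p: "p \<in> paths K u w"
    show "p \<in> paths G u w"
    proof (cases "z \<in> set p")
      case True
      then obtain q r where qr: "p = q @ z # r" by (meson split_list)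
      have "q @ [z] \<in> paths G u z" "z # r \<in> paths G z w"
        using path_split_at_paste_vertex[OF K, of G G q r u w] p assms(4,5) qr by auto
      then show ?thesis
        using p unfolding qr by (auto simp: paths_def path_edges_append[of q z r])
    next
      case False
      then have "set p \<subseteq> verts G \<and> set (path_edges p) \<subseteq> edges G"
        using p assms(4) by (intro walk_stays_in_part[OF K])
          (auto simp: paths_def dest: in_set_butlastD)
      then show ?thesis using p by (simp add: paths_def)
    qed
  qed
qed

text \<open>A path avoiding \<open>z\<close> would stay in \<open>G\<close>; its end
  \<open>w\<close> would then lie in both parts and hence be \<open>z\<close> after all.\<close>

lemma paths_pasting_cross_part:
  assumes K: "pasting G H z K" "simple_graph G" "simple_graph H"
    and u: "u \<in> verts G" and w: "w \<in> verts H" and p: "p \<in> paths K u w"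
  obtains q r where "p = q @ z # r" "q @ [z] \<in> paths G u z" "z # r \<in> paths H z w"
proof -
  have "z \<in> set p"
  proof (rule ccontr)
    assume z: "z \<notin> set p"
    then have "set p \<subseteq> verts G"
      using walk_stays_in_part[OF K, of p] p u by (auto simp: paths_def dest: in_set_butlastD)
    moreover have "w \<in> set p" using p by (auto simp: paths_def)
    ultimately have "w = z" using w K(1) by (auto simp: pasting_def)
    then show False using z \<open>w \<in> set p\<close> by simp
  qed
  then obtain q r where "p = q @ z # r" by (meson split_list)
  then show ?thesis
    using path_split_at_paste_vertex[OF K, of G H q r u w] p u w that by auto
qed

section \<open>Path ideals and splines\<close>

text \<open>The property for a single pair of vertices, so that pairs can be treated separately
  according to the part of the graph in which they lie.\<close>

definition UDP_at ::
    "('a, 'b) ring_scheme \<Rightarrow> 'v ugraph \<Rightarrow> ('v set \<Rightarrow> 'a set) \<Rightarrow> 'v \<Rightarrow> 'v \<Rightarrow> bool" where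
  "UDP_at R G \<alpha> u w \<longleftrightarrow>
     (\<forall>x \<in> paths_inter R \<alpha> G u w. \<exists>\<rho>. spline R G \<alpha> \<rho> \<and> \<rho> u \<ominus>\<^bsub>R\<^esub> \<rho> w = x)"

lemma UDP_iff: "UDP R G \<alpha> \<longleftrightarrow> (\<forall>u \<in> verts G. \<forall>w \<in> verts G. UDP_at R G \<alpha> u w)"
  by (simp add: UDP_def UDP_at_def)

context cring
begin

text \<open>The sum from \<open>path_ideal\<close>, detached from the vertex list: concatenation,
  reversal and the induction over cut edges work on lists of edges.\<close>

definition ideal_sum :: "('v set \<Rightarrow> 'a set) \<Rightarrow> 'v set list \<Rightarrow> 'a set" where
  "ideal_sum \<alpha> es = foldr (\<lambda>e I. \<alpha> e <+>\<^bsub>R\<^esub> I) es {\<zero>}"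

lemma path_ideal_eq: "path_ideal R \<alpha> p = ideal_sum \<alpha> (path_edges p)"
  by (simp add: path_ideal_def ideal_sum_def)

lemma ideal_sum_Nil [simp]: "ideal_sum \<alpha> [] = {\<zero>}"
  by (simp add: ideal_sum_def)

lemma ideal_sum_Cons [simp]: "ideal_sum \<alpha> (e # es) = \<alpha> e <+>\<^bsub>R\<^esub> ideal_sum \<alpha> es"
  by (simp add: ideal_sum_def)

lemma ideal_ideal_sum: "(\<And>e. e \<in> set es \<Longrightarrow> ideal (\<alpha> e) R) \<Longrightarrow> ideal (ideal_sum \<alpha> es) R"
  by (induction es) (auto intro: add_ideals zeroideal)

lemma mem_set_add: "x \<in> A <+>\<^bsub>R\<^esub> B \<longleftrightarrow> (\<exists>a\<in>A. \<exists>b\<in>B. x = a \<oplus> b)"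
  by (auto simp: set_add_def')

lemma ideal_closed: "ideal I R \<Longrightarrow> a \<in> I \<Longrightarrow> a \<in> carrier R"
  using ideal.Icarr by metis

lemma ideal_uminus: "ideal I R \<Longrightarrow> a \<in> I \<Longrightarrow> \<ominus> a \<in> I"
  by (meson additive_subgroup.a_inv_closed ideal.axioms(1))

lemma ideal_zero: "ideal I R \<Longrightarrow> \<zero> \<in> I"
  by (meson additive_subgroup.zero_closed ideal.axioms(1))

lemma ideal_add: "ideal I R \<Longrightarrow> a \<in> I \<Longrightarrow> b \<in> I \<Longrightarrow> a \<oplus> b \<in> I"
  by (meson additive_subgroup.a_closed ideal.axioms(1))

lemma ideal_sum_append:
  assumes "\<And>e. e \<in> set (es @ fs) \<Longrightarrow> ideal (\<alpha> e) R"
  shows "ideal_sum \<alpha> (es @ fs) = ideal_sum \<alpha> es <+>\<^bsub>R\<^esub> ideal_sum \<alpha> fs"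
  using assms
proof (induction es)
  case Nil
  have "x \<in> carrier R" if "x \<in> ideal_sum \<alpha> fs" for x
    using that ideal_closed ideal_ideal_sum[of fs \<alpha>] Nil by auto
  then show ?case by (force simp: mem_set_add)
next
  case (Cons e es)
  have I: "ideal (\<alpha> e) R" "ideal (ideal_sum \<alpha> es) R" "ideal (ideal_sum \<alpha> fs) R"
    using Cons.prems by (auto intro: ideal_ideal_sum)
  then have "\<alpha> e <+>\<^bsub>R\<^esub> (ideal_sum \<alpha> es <+>\<^bsub>R\<^esub> ideal_sum \<alpha> fs)
      = \<alpha> e <+>\<^bsub>R\<^esub> ideal_sum \<alpha> es <+>\<^bsub>R\<^esub> ideal_sum \<alpha> fs"
    using add.set_mult_assoc[of "\<alpha> e" "ideal_sum \<alpha> es" "ideal_sum \<alpha> fs"]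
    unfolding set_add_def by (metis ideal_closed subsetI)
  then show ?case using Cons by simp
qed

lemma ideal_sum_rev:
  assumes "\<And>e. e \<in> set es \<Longrightarrow> ideal (\<alpha> e) R"
  shows "ideal_sum \<alpha> (rev es) = ideal_sum \<alpha> es"
  using assms
proof (induction es)
  case (Cons e es)
  have "ideal (\<alpha> e) R" "ideal (ideal_sum \<alpha> es) R"
    using Cons.prems by (auto intro: ideal_ideal_sum)
  then have "\<alpha> e \<subseteq> carrier R" "ideal_sum \<alpha> es \<subseteq> carrier R"
    using ideal_closed by blast+
  moreover have "ideal_sum \<alpha> (rev (e # es)) = ideal_sum \<alpha> es <+>\<^bsub>R\<^esub> ideal_sum \<alpha> [e]"
    using ideal_sum_append[of "rev es" "[e]" \<alpha>] Cons by auto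
  moreover have "ideal_sum \<alpha> [e] = \<alpha> e"
    using \<open>\<alpha> e \<subseteq> carrier R\<close> by (force simp: mem_set_add)
  ultimately show ?case by (simp add: set_add_comm)
qed simp

lemma path_ideal_rev:
  assumes "edge_labeling R G \<alpha>" "p \<in> paths G u w"
  shows "path_ideal R \<alpha> (rev p) = path_ideal R \<alpha> p"
  unfolding path_ideal_eq path_edges_rev
  using assms by (intro ideal_sum_rev) (auto simp: edge_labeling_def paths_def)

lemma path_ideal_append:
  assumes "edge_labeling R G \<alpha>" "q @ z # r \<in> paths G u w"
  shows "path_ideal R \<alpha> (q @ z # r) = path_ideal R \<alpha> (q @ [z]) <+>\<^bsub>R\<^esub> path_ideal R \<alpha> (z # r)"
  unfolding path_ideal_eq path_edges_append[of q z r]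
  using assms by (intro ideal_sum_append)
    (auto simp: edge_labeling_def paths_def path_edges_append[of q z r])

lemma paths_inter_commute:
  assumes "edge_labeling R G \<alpha>"
  shows "paths_inter R \<alpha> G u w = paths_inter R \<alpha> G w u"
proof -
  have "paths_inter R \<alpha> G u w \<subseteq> paths_inter R \<alpha> G w u" for u w
  proof
    fix x assume x: "x \<in> paths_inter R \<alpha> G u w"
    have "x \<in> path_ideal R \<alpha> p" if p: "p \<in> paths G w u" for p
    proof -
      have "x \<in> path_ideal R \<alpha> (rev p)" using x paths_rev[OF p] by (auto simp: paths_inter_def)
      then show ?thesis using path_ideal_rev[OF assms p] by simp
    qed
    then show "x \<in> paths_inter R \<alpha> G w u" using x by (simp add: paths_inter_def)
  qed
  then show ?thesis by (intro subset_antisym)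
qed

section \<open>Splines and their differences along paths\<close>

lemma spline_closed: "spline R G \<alpha> \<rho> \<Longrightarrow> u \<in> verts G \<Longrightarrow> \<rho> u \<in> carrier R"
  by (auto simp: spline_def)

lemma spline_subgraph: "subgraph H G \<Longrightarrow> spline R G \<alpha> \<rho> \<Longrightarrow> spline R H \<alpha> \<rho>"
  by (auto simp: spline_def subgraph_def)

lemma spline_zero: "edge_labeling R G \<alpha> \<Longrightarrow> spline R G \<alpha> (\<lambda>_. \<zero>)"
  by (auto simp: spline_def edge_labeling_def ideal_zero a_minus_def)

lemma spline_add:
  assumes "edge_labeling R G \<alpha>" "simple_graph G" "spline R G \<alpha> \<rho>" "spline R G \<alpha> \<sigma>"
  shows "spline R G \<alpha> (\<lambda>t. \<rho> t \<oplus> \<sigma> t)"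
  unfolding spline_def
proof (intro conjI allI impI)
  show "(\<lambda>t. \<rho> t \<oplus> \<sigma> t) \<in> verts G \<rightarrow> carrier R"
    using assms(3,4) by (auto simp: spline_def)
  fix a b assume ab: "{a, b} \<in> edges G"
  then have "a \<in> verts G" "b \<in> verts G" using simple_graph_edgeD[OF assms(2)] by auto
  then have c: "\<rho> a \<in> carrier R" "\<rho> b \<in> carrier R" "\<sigma> a \<in> carrier R" "\<sigma> b \<in> carrier R"
    using assms(3,4) by (auto intro: spline_closed)
  have "(\<rho> a \<ominus> \<rho> b) \<oplus> (\<sigma> a \<ominus> \<sigma> b) \<in> \<alpha> {a, b}"
    using ab assms by (intro ideal_add) (auto simp: spline_def edge_labeling_def)
  moreover have "(\<rho> a \<ominus> \<rho> b) \<oplus> (\<sigma> a \<ominus> \<sigma> b) = (\<rho> a \<oplus> \<sigma> a) \<ominus> (\<rho> b \<oplus> \<sigma> b)"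
    using c by algebra
  ultimately show "(\<rho> a \<oplus> \<sigma> a) \<ominus> (\<rho> b \<oplus> \<sigma> b) \<in> \<alpha> {a, b}" by simp
qed

text \<open>Telescoping: the difference of the end values is the sum of the differences across the
  edges, each of which lies in the label of its edge.\<close>

lemma spline_diff_in_path_ideal:
  assumes "edge_labeling R G \<alpha>" "spline R G \<alpha> \<rho>"
    and "p \<noteq> []" "set p \<subseteq> verts G" "set (path_edges p) \<subseteq> edges G"
  shows "\<rho> (hd p) \<ominus> \<rho> (last p) \<in> path_ideal R \<alpha> p"
  using assms(3-)
proof (induction p rule: induct_list012)
  case (2 a)
  then have "\<rho> a \<in> carrier R" using assms(2) spline_closed by auto
  then show ?case by (simp add: path_ideal_eq a_minus_def r_neg)
next
  case (3 a b p)
  have c: "\<rho> a \<in> carrier R" "\<rho> b \<in> carrier R" "\<rho> (last (b # p)) \<in> carrier R"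
    using 3(4) last_in_set[of "b # p"] by (auto intro!: spline_closed[OF assms(2)] simp del: last.simps)
  have "\<rho> a \<ominus> \<rho> (last (b # p)) = (\<rho> a \<ominus> \<rho> b) \<oplus> (\<rho> b \<ominus> \<rho> (last (b # p)))"
    using c by algebra
  moreover have "\<rho> a \<ominus> \<rho> b \<in> \<alpha> {a, b}" using 3 assms(2) by (auto simp: spline_def)
  moreover have "\<rho> b \<ominus> \<rho> (last (b # p)) \<in> path_ideal R \<alpha> (b # p)" using 3 by auto
  ultimately have "\<rho> a \<ominus> \<rho> (last (b # p)) \<in> \<alpha> {a, b} <+>\<^bsub>R\<^esub> path_ideal R \<alpha> (b # p)"
    unfolding mem_set_add by blast
  then show ?case by (simp add: path_ideal_eq)
qed simp

text \<open>Differences of spline values always lie in the intersection of the path ideals; the UDP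
  asks that all of the intersection be attained in this way.\<close>

lemma spline_diff_in_paths_inter:
  assumes "edge_labeling R G \<alpha>" "spline R G \<alpha> \<rho>" "u \<in> verts G" "w \<in> verts G"
  shows "\<rho> u \<ominus> \<rho> w \<in> paths_inter R \<alpha> G u w"
proof -
  have "\<rho> u \<ominus> \<rho> w \<in> path_ideal R \<alpha> p" if "p \<in> paths G u w" for p
    using spline_diff_in_path_ideal[OF assms(1,2), of p] that by (auto simp: paths_def)
  then show ?thesis
    using assms(3,4) spline_closed[OF assms(2)] by (simp add: paths_inter_def)
qed

lemma paths_inter_uminus:
  assumes "edge_labeling R G \<alpha>" "x \<in> paths_inter R \<alpha> G u w"
  shows "\<ominus> x \<in> paths_inter R \<alpha> G u w"
proof -
  have "ideal (path_ideal R \<alpha> p) R" if "p \<in> paths G u w" for p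
    using that assms(1) unfolding path_ideal_eq
    by (intro ideal_ideal_sum) (auto simp: edge_labeling_def paths_def)
  then show ?thesis using assms(2) by (auto simp: paths_inter_def ideal_uminus)
qed

text \<open>The intersection is unchanged by reversing paths and is closed under negation, so a
  spline realising the negative of \<open>x\<close> from \<open>u\<close> to \<open>w\<close>
  realises \<open>x\<close> from \<open>w\<close> to \<open>u\<close>.\<close>

lemma UDP_at_commute:
  assumes "edge_labeling R G \<alpha>" "u \<in> verts G" "w \<in> verts G" "UDP_at R G \<alpha> u w"
  shows "UDP_at R G \<alpha> w u"
  unfolding UDP_at_def
proof
  fix x assume x: "x \<in> paths_inter R \<alpha> G w u"
  then have "\<ominus> x \<in> paths_inter R \<alpha> G u w"
    using paths_inter_uminus paths_inter_commute assms(1) by metis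
  then obtain \<rho> where \<rho>: "spline R G \<alpha> \<rho>" "\<rho> u \<ominus> \<rho> w = \<ominus> x"
    using assms(4) by (auto simp: UDP_at_def)
  have "\<rho> u \<in> carrier R" "\<rho> w \<in> carrier R" "x \<in> carrier R"
    using \<rho> assms x spline_closed by (auto simp: paths_inter_def)
  moreover from this have "\<rho> w \<ominus> \<rho> u = \<ominus> (\<rho> u \<ominus> \<rho> w)" by algebra
  ultimately have "\<rho> w \<ominus> \<rho> u = x" using \<rho>(2) by simp
  then show "\<exists>\<rho>. spline R G \<alpha> \<rho> \<and> \<rho> w \<ominus> \<rho> u = x" using \<rho>(1) by blast
qed

section \<open>The Universal Difference Property under pasting\<close>

text \<open>Adding a constant to \<open>\<sigma>\<close> changes no difference along an edge of
  \<open>H\<close>. The constant is chosen to make the shifted \<open>\<sigma>\<close> agree with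
  \<open>\<rho>\<close> at \<open>z\<close>, the only vertex where both prescriptions apply.\<close>

lemma spline_glue:
  assumes K: "pasting G H z K" and sG: "simple_graph G" and sH: "simple_graph H"
    and \<rho>: "spline R G \<alpha> \<rho>" and \<sigma>: "spline R H \<alpha> \<sigma>"
  obtains \<tau> where "spline R K \<alpha> \<tau>" "\<And>t. t \<in> verts G \<Longrightarrow> \<tau> t = \<rho> t"
    "\<And>t. t \<in> verts H \<Longrightarrow> \<tau> t = \<sigma> t \<oplus> (\<rho> z \<ominus> \<sigma> z)"
proof -
  define \<tau> where "\<tau> t = (if t \<in> verts G then \<rho> t else \<sigma> t \<oplus> (\<rho> z \<ominus> \<sigma> z))" for t
  have z: "z \<in> verts G" "z \<in> verts H" using K by (auto simp: pasting_def)
  have cz: "\<rho> z \<in> carrier R" "\<sigma> z \<in> carrier R" using \<rho> \<sigma> z by (auto intro: spline_closed)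
  have \<tau>G: "\<tau> t = \<rho> t" if "t \<in> verts G" for t using that by (simp add: \<tau>_def)
  have \<tau>H: "\<tau> t = \<sigma> t \<oplus> (\<rho> z \<ominus> \<sigma> z)" if "t \<in> verts H" for t
  proof (cases "t \<in> verts G")
    case True
    then have "t = z" using that K by (auto simp: pasting_def)
    moreover have "\<rho> z = \<sigma> z \<oplus> (\<rho> z \<ominus> \<sigma> z)" using cz by algebra
    ultimately show ?thesis using True by (simp add: \<tau>_def)
  qed (simp add: \<tau>_def)
  have "spline R K \<alpha> \<tau>"
    unfolding spline_def
  proof (intro conjI allI impI)
    show "\<tau> \<in> verts K \<rightarrow> carrier R"
      using K \<rho> \<sigma> \<tau>G \<tau>H cz by (auto simp: pasting_def graph_union_def spline_closed)
    fix a b assume "{a, b} \<in> edges K"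
    then consider "{a, b} \<in> edges G" | "{a, b} \<in> edges H"
      using K by (auto simp: pasting_def graph_union_def)
    then show "\<tau> a \<ominus> \<tau> b \<in> \<alpha> {a, b}"
    proof cases
      case 1
      then show ?thesis using simple_graph_edgeD[OF sG 1] \<tau>G \<rho> by (simp add: spline_def)
    next
      case 2
      have ab: "a \<in> verts H" "b \<in> verts H" using simple_graph_edgeD[OF sH 2] by auto
      then have "\<sigma> a \<in> carrier R" "\<sigma> b \<in> carrier R" using \<sigma> by (auto intro: spline_closed)
      then have "(\<sigma> a \<oplus> (\<rho> z \<ominus> \<sigma> z)) \<ominus> (\<sigma> b \<oplus> (\<rho> z \<ominus> \<sigma> z)) = \<sigma> a \<ominus> \<sigma> b"
        using cz by algebra
      then show ?thesis using ab \<tau>H \<sigma> 2 by (simp add: spline_def)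
    qed
  qed
  then show ?thesis using that \<tau>G \<tau>H by blast
qed

lemma pasting_subgraph: "pasting G H z K \<Longrightarrow> subgraph G K \<and> subgraph H K"
  by (auto simp: pasting_def graph_union_def subgraph_def)

lemma edge_labeling_subgraph: "subgraph H G \<Longrightarrow> edge_labeling R G \<alpha> \<Longrightarrow> edge_labeling R H \<alpha>"
  by (auto simp: subgraph_def edge_labeling_def)

text \<open>Both intersections run over the same paths. A spline on \<open>G\<close> extends to
  \<open>K\<close> by gluing it with the zero spline on \<open>H\<close>, which makes it constant on
  \<open>H\<close> with the value at \<open>z\<close>.\<close>

lemma UDP_at_pasting_part:
  assumes K: "pasting G H z K" "simple_graph G" "simple_graph H" and \<alpha>: "edge_labeling R K \<alpha>"
    and uw: "u \<in> verts G" "w \<in> verts G"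
  shows "UDP_at R K \<alpha> u w \<longleftrightarrow> UDP_at R G \<alpha> u w"
proof -
  have eq: "paths_inter R \<alpha> K u w = paths_inter R \<alpha> G u w"
    using paths_pasting_same_part[OF K uw] by (simp add: paths_inter_def)
  have H: "edge_labeling R H \<alpha>" using pasting_subgraph[OF K(1)] \<alpha> edge_labeling_subgraph by metis
  have "(\<exists>\<tau>. spline R K \<alpha> \<tau> \<and> \<tau> u \<ominus> \<tau> w = x) \<longleftrightarrow> (\<exists>\<rho>. spline R G \<alpha> \<rho> \<and> \<rho> u \<ominus> \<rho> w = x)" for x
  proof
    assume "\<exists>\<tau>. spline R K \<alpha> \<tau> \<and> \<tau> u \<ominus> \<tau> w = x"
    then show "\<exists>\<rho>. spline R G \<alpha> \<rho> \<and> \<rho> u \<ominus> \<rho> w = x"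
      using spline_subgraph pasting_subgraph[OF K(1)] by blast
  next
    assume "\<exists>\<rho>. spline R G \<alpha> \<rho> \<and> \<rho> u \<ominus> \<rho> w = x"
    then obtain \<rho> where \<rho>: "spline R G \<alpha> \<rho>" "\<rho> u \<ominus> \<rho> w = x" by blast
    show "\<exists>\<tau>. spline R K \<alpha> \<tau> \<and> \<tau> u \<ominus> \<tau> w = x"
      using spline_glue[OF K \<rho>(1) spline_zero[OF H]] uw \<rho>(2) by metis
  qed
  then show ?thesis unfolding UDP_at_def eq by simp
qed

lemma UDP_pasting_left:
  assumes "pasting G H z K" "simple_graph G" "simple_graph H" "edge_labeling R K \<alpha>" "UDP R K \<alpha>"
  shows "UDP R G \<alpha>"
  unfolding UDP_iff
proof (intro ballI)
  fix u w assume uw: "u \<in> verts G" "w \<in> verts G"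
  then have "UDP_at R K \<alpha> u w"
    using assms(1,5) by (auto simp: UDP_iff pasting_def graph_union_def)
  then show "UDP_at R G \<alpha> u w" using UDP_at_pasting_part[OF assms(1-4) uw] by simp
qed

text \<open>A spline difference from \<open>u\<close> to \<open>w\<close> is the difference from
  \<open>u\<close> to \<open>z\<close> plus the one from \<open>z\<close> to \<open>w\<close>, and
  these lie in the two summands of the formula. Conversely, a decomposition of \<open>x\<close> by
  the formula gives one spline on each part, and gluing them realises \<open>x\<close>.\<close>

theorem UDP_pasting_iff:
  assumes K: "pasting G H z K" "simple_graph G" "simple_graph H" and \<alpha>: "edge_labeling R K \<alpha>"
    and UG: "UDP R G \<alpha>" and UH: "UDP R H \<alpha>"
  shows "UDP R K \<alpha> \<longleftrightarrow> (\<forall>u \<in> verts G. \<forall>w \<in> verts H.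
    paths_inter R \<alpha> K u w = paths_inter R \<alpha> G u z <+>\<^bsub>R\<^esub> paths_inter R \<alpha> H z w)"
    (is "_ \<longleftrightarrow> ?formula")
proof
  have z: "z \<in> verts G" "z \<in> verts H" using K by (auto simp: pasting_def)
  have sub: "subgraph G K" "subgraph H K" using pasting_subgraph[OF K(1)] by auto
  have VK: "verts K = verts G \<union> verts H" using K(1) by (auto simp: pasting_def graph_union_def)
  note \<alpha>G = edge_labeling_subgraph[OF sub(1) \<alpha>] and \<alpha>H = edge_labeling_subgraph[OF sub(2) \<alpha>]
  {
    assume UK: "UDP R K \<alpha>"
    show ?formula
    proof (intro ballI subset_antisym subsetI)
      fix u w x assume uw: "u \<in> verts G" "w \<in> verts H"
      assume x: "x \<in> paths_inter R \<alpha> K u w"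
      have "UDP_at R K \<alpha> u w" using UK uw VK by (simp add: UDP_iff)
      then obtain \<rho> where \<rho>: "spline R K \<alpha> \<rho>" "\<rho> u \<ominus> \<rho> w = x"
        using x unfolding UDP_at_def by blast
      have "\<rho> u \<in> carrier R" "\<rho> w \<in> carrier R" "\<rho> z \<in> carrier R"
        using \<rho>(1) uw z VK by (auto intro: spline_closed)
      then have "\<rho> u \<ominus> \<rho> w = (\<rho> u \<ominus> \<rho> z) \<oplus> (\<rho> z \<ominus> \<rho> w)" by algebra
      moreover have "\<rho> u \<ominus> \<rho> z \<in> paths_inter R \<alpha> G u z"
        using spline_diff_in_paths_inter[OF \<alpha>G] spline_subgraph[OF sub(1) \<rho>(1)] uw z by blast
      moreover have "\<rho> z \<ominus> \<rho> w \<in> paths_inter R \<alpha> H z w"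
        using spline_diff_in_paths_inter[OF \<alpha>H] spline_subgraph[OF sub(2) \<rho>(1)] uw z by blast
      ultimately show "x \<in> paths_inter R \<alpha> G u z <+>\<^bsub>R\<^esub> paths_inter R \<alpha> H z w"
        using \<rho>(2) by (auto simp: mem_set_add)
    next
      fix u w x assume uw: "u \<in> verts G" "w \<in> verts H"
      assume "x \<in> paths_inter R \<alpha> G u z <+>\<^bsub>R\<^esub> paths_inter R \<alpha> H z w"
      then obtain a b where ab: "a \<in> paths_inter R \<alpha> G u z" "b \<in> paths_inter R \<alpha> H z w" "x = a \<oplus> b"
        by (auto simp: mem_set_add)
      \<comment> \<open>Every path from \<open>G\<close> to \<open>H\<close> is cut at
        \<open>z\<close>; \<open>a\<close> lies in the ideal of the first half and \<open>b\<close>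
        in that of the second.\<close>
      have "x \<in> path_ideal R \<alpha> p" if p: "p \<in> paths K u w" for p
      proof -
        obtain q r where qr: "p = q @ z # r" "q @ [z] \<in> paths G u z" "z # r \<in> paths H z w"
          using paths_pasting_cross_part[OF K uw p] by blast
        then have "a \<in> path_ideal R \<alpha> (q @ [z])" "b \<in> path_ideal R \<alpha> (z # r)"
          using ab by (auto simp: paths_inter_def)
        then show ?thesis
          using path_ideal_append[OF \<alpha>] p ab(3) unfolding qr(1) by (auto simp: mem_set_add)
      qed
      then show "x \<in> paths_inter R \<alpha> K u w" using ab by (auto simp: paths_inter_def)
    qed
  next
    assume F: ?formula
    \<comment> \<open>The formula enters only for the crossing pairs: pairs inside one part inherit
      the property from that part, and pairs from \<open>H\<close> to \<open>G\<close> follow by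
      symmetry.\<close>
    have GG: "UDP_at R K \<alpha> u w" if "u \<in> verts G" "w \<in> verts G" for u w
      using UDP_at_pasting_part[OF K \<alpha>] that UG by (auto simp: UDP_iff)
    have HH: "UDP_at R K \<alpha> u w" if "u \<in> verts H" "w \<in> verts H" for u w
      using UDP_at_pasting_part[of H G z K] K \<alpha> that UH pasting_commute[of G H]
      by (auto simp: UDP_iff)
    have GH: "UDP_at R K \<alpha> u w" if uw: "u \<in> verts G" "w \<in> verts H" for u w
      unfolding UDP_at_def
    proof
      fix x assume "x \<in> paths_inter R \<alpha> K u w"
      then have "x \<in> paths_inter R \<alpha> G u z <+>\<^bsub>R\<^esub> paths_inter R \<alpha> H z w"
        using F uw by simp
      then obtain a b where ab: "a \<in> paths_inter R \<alpha> G u z" "b \<in> paths_inter R \<alpha> H z w" "x = a \<oplus> b"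
        unfolding mem_set_add by blast
      obtain \<rho> where \<rho>: "spline R G \<alpha> \<rho>" "\<rho> u \<ominus> \<rho> z = a"
        using UG ab(1) uw z unfolding UDP_def by blast
      obtain \<sigma> where \<sigma>: "spline R H \<alpha> \<sigma>" "\<sigma> z \<ominus> \<sigma> w = b"
        using UH ab(2) uw z unfolding UDP_def by blast
      obtain \<tau> where \<tau>: "spline R K \<alpha> \<tau>" "\<tau> u = \<rho> u" "\<tau> w = \<sigma> w \<oplus> (\<rho> z \<ominus> \<sigma> z)"
        using spline_glue[OF K \<rho>(1) \<sigma>(1)] uw by metis
      have "\<rho> u \<in> carrier R" "\<rho> z \<in> carrier R" "\<sigma> z \<in> carrier R" "\<sigma> w \<in> carrier R"
        using \<rho>(1) \<sigma>(1) uw z by (auto intro: spline_closed)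
      then have "\<rho> u \<ominus> (\<sigma> w \<oplus> (\<rho> z \<ominus> \<sigma> z)) = (\<rho> u \<ominus> \<rho> z) \<oplus> (\<sigma> z \<ominus> \<sigma> w)" by algebra
      then show "\<exists>\<tau>. spline R K \<alpha> \<tau> \<and> \<tau> u \<ominus> \<tau> w = x"
        using \<tau> \<rho>(2) \<sigma>(2) ab(3) by metis
    qed
    show "UDP R K \<alpha>"
      unfolding UDP_iff VK using GG HH GH UDP_at_commute[OF \<alpha>] VK by (metis Un_iff)
  }
qed

section \<open>Trees\<close>

text \<open>Built on a bare edge set, so that deleting an edge is a set difference and reachability
  is the reflexive transitive closure.\<close>

definition adjacency :: "'v set set \<Rightarrow> ('v \<times> 'v) set" where
  "adjacency E = {(a, b). {a, b} \<in> E}"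

lemma sym_rtrancl_adjacency: "(a, b) \<in> (adjacency E)\<^sup>* \<Longrightarrow> (b, a) \<in> (adjacency E)\<^sup>*"
proof -
  have "sym (adjacency E)" by (auto simp: adjacency_def sym_def insert_commute)
  then show "(a, b) \<in> (adjacency E)\<^sup>* \<Longrightarrow> (b, a) \<in> (adjacency E)\<^sup>*"
    by (meson symD sym_rtrancl)
qed

lemma walk_rtrancl_adjacency:
  "p \<noteq> [] \<Longrightarrow> set (path_edges p) \<subseteq> E \<Longrightarrow> (hd p, last p) \<in> (adjacency E)\<^sup>*"
proof (induction p rule: induct_list012)
  case (3 a b p)
  then have "(a, b) \<in> adjacency E" "(b, last (b # p)) \<in> (adjacency E)\<^sup>*"
    by (auto simp: adjacency_def)
  then show ?case using converse_rtrancl_into_rtrancl[of a b] by simp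
qed auto

text \<open>A path is extended at the front. If the new vertex already occurs on it, the part before
  that occurrence is dropped, which keeps the vertices distinct.\<close>

lemma rtrancl_adjacency_path:
  assumes "(a, b) \<in> (adjacency E)\<^sup>*"
  shows "\<exists>p. p \<noteq> [] \<and> hd p = a \<and> last p = b \<and> distinct p \<and> set (path_edges p) \<subseteq> E"
  using assms
proof (induction rule: converse_rtrancl_induct)
  case base
  show ?case by (rule exI[of _ "[b]"]) simp
next
  case (step a c)
  then obtain p where p: "p \<noteq> []" "hd p = c" "last p = b" "distinct p" "set (path_edges p) \<subseteq> E"
    by blast
  show ?case
  proof (cases "a \<in> set p")
    case True
    then obtain q r where qr: "p = q @ a # r" by (meson split_list)
    then show ?thesis
      using p by (intro exI[of _ "a # r"]) (auto simp: path_edges_append[of q a r])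
  next
    case False
    obtain r where "p = c # r" using p(1,2) by (cases p) auto
    then show ?thesis
      using p step(1) False by (intro exI[of _ "a # p"]) (auto simp: adjacency_def)
  qed
qed

lemma path_edges_split:
  "e \<in> set (path_edges p) \<Longrightarrow> \<exists>q a b r. p = q @ a # b # r \<and> e = {a, b}"
proof (induction p rule: induct_list012)
  case (3 a b p)
  show ?case
  proof (cases "e = {a, b}")
    case True
    then show ?thesis by (intro exI[of _ "[]"]) auto
  next
    case False
    then obtain q c d r where "b # p = q @ c # d # r" "e = {c, d}" using 3 by auto
    then show ?thesis by (metis append_Cons)
  qed
qed auto

lemma walk_verts:
  assumes "simple_graph G"
  shows "p \<noteq> [] \<Longrightarrow> hd p \<in> verts G \<Longrightarrow> set (path_edges p) \<subseteq> edges G \<Longrightarrow> set p \<subseteq> verts G"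
proof (induction p rule: induct_list012)
  case (3 a b p)
  then show ?case using simple_graph_edgeD[OF assms, of a b] by auto
qed auto

text \<open>Supplies the cycle that a tree must not contain. The shift to \<open>k - 1\<close>
  reconciles list positions, counted from 0, with the numbering of \<open>cycle_graph\<close>, which
  starts at 1.\<close>

lemma path_closed_by_edge_is_cycle:
  assumes "distinct c" "length c \<ge> 3"
  shows "cycle_graph \<lparr>verts = set c, edges = set (path_edges c) \<union> {{last c, hd c}}\<rparr>
    (length c) (\<lambda>k. c ! (k - 1))"
proof -
  have "inj_on (\<lambda>k. c ! (k - 1)) {1..length c}"
    using assms(1) by (auto simp: inj_on_def nth_eq_iff_index_eq)
  moreover have "set c = (\<lambda>k. c ! (k - 1)) ` {1..length c}"
  proof -
    have "set c = (!) c ` {..<length c}" by (auto simp: set_conv_nth)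
    also have "{..<length c} = (\<lambda>k. k - 1) ` {1..length c}"
    proof -
      have "k \<in> (\<lambda>k. k - 1) ` {1..length c}" if "k < length c" for k
        using that by (intro image_eqI[of _ _ "Suc k"]) auto
      then show ?thesis by auto
    qed
    finally show ?thesis by (simp add: image_image)
  qed
  moreover have "set (path_edges c) = {{c ! (k - 1), c ! (k + 1 - 1)} | k. 1 \<le> k \<and> k < length c}"
  proof -
    have "\<exists>l. {c ! k, c ! (k + 1)} = {c ! (l - 1), c ! (l + 1 - 1)} \<and> 1 \<le> l \<and> l < length c"
      if "k + 1 < length c" for k
      using that by (intro exI[of _ "k + 1"]) auto
    moreover have "\<exists>l. {c ! (k - 1), c ! (k + 1 - 1)} = {c ! l, c ! (l + 1)} \<and> l + 1 < length c"
      if "1 \<le> k" "k < length c" for k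
      using that by (intro exI[of _ "k - 1"]) auto
    ultimately show ?thesis unfolding set_path_edges by blast
  qed
  moreover have "c \<noteq> []" using assms(2) by auto
  ultimately show ?thesis
    using assms(2) by (simp add: cycle_graph_def last_conv_nth hd_conv_nth)
qed

text \<open>Otherwise one end of \<open>e\<close> could be joined to the other through
  \<open>u\<close> and \<open>w\<close> without using \<open>e\<close>. A path extracted from that
  connection, closed up by \<open>e\<close>, would be a cycle in \<open>T\<close>.\<close>

lemma tree_path_edge_separates:
  assumes T: "tree_graph T" and p: "p \<in> paths T u w" and e: "e \<in> set (path_edges p)"
  shows "(u, w) \<notin> (adjacency (edges T - {e}))\<^sup>*"
proof
  let ?E = "edges T - {e}"
  assume uw: "(u, w) \<in> (adjacency ?E)\<^sup>*"
  have sT: "simple_graph T" using T by (simp add: tree_graph_def)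
  obtain q a b r where qr: "p = q @ a # b # r" "e = {a, b}" using path_edges_split[OF e] by blast
  have p': "hd p = u" "last (b # r) = w" "distinct p" "set p \<subseteq> verts T"
    "set (path_edges (q @ [a])) \<subseteq> edges T" "set (path_edges (b # r)) \<subseteq> edges T" "{a, b} \<in> edges T"
    using p unfolding qr(1) by (auto simp: paths_def path_edges_append[of q a "b # r"])
  \<comment> \<open>Distinctness keeps \<open>b\<close> out of the initial piece, and likewise
    \<open>a\<close> out of the final one, so neither piece uses \<open>e\<close>.\<close>
  have "e \<notin> set (path_edges (q @ [a]))"
    using p'(3) qr path_edges_subset[of e "q @ [a]"] by auto
  then have "(hd (q @ [a]), last (q @ [a])) \<in> (adjacency ?E)\<^sup>*"
    using p'(5) by (intro walk_rtrancl_adjacency) auto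
  moreover have "hd (q @ [a]) = u" using p'(1) qr(1) by (cases q) auto
  ultimately have "(a, u) \<in> (adjacency ?E)\<^sup>*" by (simp add: sym_rtrancl_adjacency)
  have "e \<notin> set (path_edges (b # r))"
    using p'(3) qr path_edges_subset[of e "b # r"] by auto
  then have "(hd (b # r), last (b # r)) \<in> (adjacency ?E)\<^sup>*"
    using p'(6) by (intro walk_rtrancl_adjacency) auto
  then have "(w, b) \<in> (adjacency ?E)\<^sup>*" using p'(2) sym_rtrancl_adjacency by fastforce
  with uw \<open>(a, u) \<in> _\<close> have "(a, b) \<in> (adjacency ?E)\<^sup>*" by (meson rtrancl_trans)
  then obtain c where c: "c \<noteq> []" "hd c = a" "last c = b" "distinct c" "set (path_edges c) \<subseteq> ?E"
    using rtrancl_adjacency_path by metis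
  have "a \<noteq> b" using p'(3) qr(1) by auto
  \<comment> \<open>One vertex would force \<open>a = b\<close>, and with two vertices the only edge
    would be the deleted edge \<open>e\<close>.\<close>
  have "length c \<ge> 3"
  proof (rule ccontr)
    assume short: "\<not> length c \<ge> 3"
    obtain d where d: "c = a # d" using c(1,2) by (cases c) auto
    then have "d \<noteq> []" using c(3) \<open>a \<noteq> b\<close> by auto
    then obtain y where "d = [y]" using d short by (cases d; cases "tl d") auto
    then have "d = [b]" using c(3) d by simp
    then show False using c(5) d qr(2) by simp
  qed
  moreover have "set c \<subseteq> verts T"
    using c p'(4) qr(1) by (intro walk_verts[OF sT]) auto
  then have "subgraph \<lparr>verts = set c, edges = set (path_edges c) \<union> {{last c, hd c}}\<rparr> T"
    using c p'(7) by (auto simp: subgraph_def insert_commute)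
  ultimately show False
    using path_closed_by_edge_is_cycle[OF c(4)] T unfolding tree_graph_def by blast
qed

section \<open>Splines from separating edges\<close>

text \<open>The spline is \<open>x\<close> on everything reachable from \<open>u\<close> without
  \<open>e\<close>, and zero elsewhere. Edges other than \<open>e\<close> join equal values; across
  \<open>e\<close> the difference is zero, \<open>x\<close> or its negative, all in
  \<open>\<alpha> e\<close>.\<close>

lemma spline_of_cut:
  assumes \<alpha>: "edge_labeling R G \<alpha>" and e: "e \<in> edges G" and x: "x \<in> \<alpha> e"
    and sep: "(u, w) \<notin> (adjacency (edges G - {e}))\<^sup>*"
  shows "\<exists>\<rho>. spline R G \<alpha> \<rho> \<and> \<rho> u = x \<and> \<rho> w = \<zero>"
proof -
  define \<rho> where "\<rho> t = (if (u, t) \<in> (adjacency (edges G - {e}))\<^sup>* then x else \<zero>)" for t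
  have I: "ideal (\<alpha> f) R" if "f \<in> edges G" for f using \<alpha> that by (simp add: edge_labeling_def)
  have xc: "x \<in> carrier R" using ideal_closed I e x by metis
  have "\<rho> a \<ominus> \<rho> b \<in> \<alpha> {a, b}" if ab: "{a, b} \<in> edges G" for a b
  proof (cases "{a, b} = e")
    case True
    then show ?thesis
      using I[OF e] x xc
      by (auto simp: \<rho>_def a_minus_def r_neg ideal_zero ideal_uminus)
  next
    case False
    then have "(a, b) \<in> adjacency (edges G - {e})" "(b, a) \<in> adjacency (edges G - {e})"
      using ab by (auto simp: adjacency_def insert_commute)
    then have "\<rho> a = \<rho> b" unfolding \<rho>_def by (meson rtrancl.rtrancl_into_rtrancl)
    then show ?thesis using I[OF ab] xc by (auto simp: \<rho>_def a_minus_def r_neg ideal_zero)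
  qed
  then have "spline R G \<alpha> \<rho>" using xc by (auto simp: spline_def \<rho>_def)
  moreover have "\<rho> u = x" "\<rho> w = \<zero>" using sep by (auto simp: \<rho>_def)
  ultimately show ?thesis by blast
qed

text \<open>\<open>x\<close> is a sum of one contribution per edge; the splines that realise these
  contributions are added. Normalising each to zero at \<open>w\<close> makes the values at
  \<open>u\<close> add up to \<open>x\<close>.\<close>

lemma spline_of_cuts:
  assumes \<alpha>: "edge_labeling R G \<alpha>" and G: "simple_graph G"
    and es: "\<And>e. e \<in> set es \<Longrightarrow> e \<in> edges G \<and> (u, w) \<notin> (adjacency (edges G - {e}))\<^sup>*"
    and x: "x \<in> ideal_sum \<alpha> es"
  shows "\<exists>\<rho>. spline R G \<alpha> \<rho> \<and> \<rho> u = x \<and> \<rho> w = \<zero>"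
  using es x
proof (induction es arbitrary: x)
  case Nil
  then show ?case using spline_zero[OF \<alpha>] by (intro exI[of _ "\<lambda>_. \<zero>"]) simp
next
  case (Cons e es)
  obtain a b where ab: "a \<in> \<alpha> e" "b \<in> ideal_sum \<alpha> es" "x = a \<oplus> b"
    using Cons.prems(2) by (auto simp: mem_set_add)
  obtain \<rho> where \<rho>: "spline R G \<alpha> \<rho>" "\<rho> u = a" "\<rho> w = \<zero>"
    using spline_of_cut[OF \<alpha> _ ab(1)] Cons.prems(1)[of e] by auto
  obtain \<sigma> where \<sigma>: "spline R G \<alpha> \<sigma>" "\<sigma> u = b" "\<sigma> w = \<zero>"
    using Cons.IH[OF _ ab(2)] Cons.prems(1) by auto
  show ?case
    using spline_add[OF \<alpha> G \<rho>(1) \<sigma>(1)] \<rho> \<sigma> ab(3) by (intro exI[of _ "\<lambda>t. \<rho> t \<oplus> \<sigma> t"]) simp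
qed

lemma UDP_tree:
  assumes T: "tree_graph T" and \<alpha>: "edge_labeling R T \<alpha>"
  shows "UDP R T \<alpha>"
  unfolding UDP_def
proof (intro ballI)
  fix u w x assume uw: "u \<in> verts T" "w \<in> verts T" and x: "x \<in> paths_inter R \<alpha> T u w"
  \<comment> \<open>A single path suffices: \<open>x\<close> lies in its path ideal, and each of its
    edges separates \<open>u\<close> from \<open>w\<close>.\<close>
  obtain p where p: "p \<in> paths T u w"
    using T uw unfolding tree_graph_def connected_graph_def by blast
  then have "x \<in> ideal_sum \<alpha> (path_edges p)" "x \<in> carrier R"
    using x by (auto simp: paths_inter_def path_ideal_eq)
  moreover have "e \<in> edges T \<and> (u, w) \<notin> (adjacency (edges T - {e}))\<^sup>*"
    if "e \<in> set (path_edges p)" for e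
    using that p tree_path_edge_separates[OF T p that] by (auto simp: paths_def)
  ultimately obtain \<rho> where "spline R T \<alpha> \<rho>" "\<rho> u = x" "\<rho> w = \<zero>"
    using spline_of_cuts[OF \<alpha>] T unfolding tree_graph_def by metis
  then show "\<exists>\<rho>. spline R T \<alpha> \<rho> \<and> \<rho> u \<ominus> \<rho> w = x"
    using \<open>x \<in> carrier R\<close> by (intro exI[of _ \<rho>]) (simp add: a_minus_def)
qed

section \<open>Cycles\<close>

text \<open>The value at a vertex is the sum of the contributions of the edges from there to the
  end, so it drops from \<open>x\<close> to zero along the path.\<close>

lemma path_spline:
  assumes "p \<noteq> []" "distinct p" "\<And>e. e \<in> set (path_edges p) \<Longrightarrow> ideal (\<alpha> e) R"
    and "x \<in> path_ideal R \<alpha> p"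
  shows "\<exists>\<rho>. spline R \<lparr>verts = set p, edges = set (path_edges p)\<rparr> \<alpha> \<rho>
    \<and> \<rho> (hd p) = x \<and> \<rho> (last p) = \<zero>"
  using assms
proof (induction p arbitrary: x rule: induct_list012)
  case (2 a)
  then show ?case by (intro exI[of _ "\<lambda>_. \<zero>"]) (simp add: spline_def path_ideal_eq)
next
  case (3 a b p)
  obtain c y where cy: "c \<in> \<alpha> {a, b}" "y \<in> path_ideal R \<alpha> (b # p)" "x = c \<oplus> y"
    using 3(6) by (auto simp: path_ideal_eq mem_set_add)
  obtain \<rho> where \<rho>: "spline R \<lparr>verts = set (b # p), edges = set (path_edges (b # p))\<rparr> \<alpha> \<rho>"
      "\<rho> b = y" "\<rho> (last (b # p)) = \<zero>"
    using 3(2)[OF _ _ _ cy(2)] 3(4,5) by auto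
  have I: "ideal (\<alpha> {a, b}) R" using 3(5) by simp
  have car: "c \<in> carrier R" "y \<in> carrier R"
    using ideal_closed[OF I cy(1)] \<rho>(1,2) by (auto simp: spline_def)
  \<comment> \<open>Since \<open>a\<close> does not occur in \<open>b # p\<close>, the new value
    affects only the edge from \<open>a\<close> to \<open>b\<close>, where the difference is
    \<open>c\<close>.\<close>
  define \<sigma> where "\<sigma> = \<rho>(a := x)"
  have a: "a \<notin> set (b # p)" using 3(4) by auto
  have "\<sigma> s \<ominus> \<sigma> t \<in> \<alpha> {s, t}" if st: "{s, t} \<in> set (path_edges (a # b # p))" for s t
  proof (cases "{s, t} = {a, b}")
    case True
    \<comment> \<open>An unordered edge can be read in either direction, so both signs of the
      difference are required.\<close>
    have "x \<ominus> y = c" "y \<ominus> x = \<ominus> c" using car unfolding cy(3) by algebra+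
    then show ?thesis
      using True a \<rho>(2) I cy(1) ideal_uminus[OF I cy(1)]
      by (auto simp: \<sigma>_def doubleton_eq_iff insert_commute)
  next
    case False
    then have st': "{s, t} \<in> set (path_edges (b # p))" using st by auto
    then have "s \<noteq> a" "t \<noteq> a" using path_edges_subset[OF st'] a by auto
    then show ?thesis using \<rho>(1) st' by (simp add: \<sigma>_def spline_def)
  qed
  moreover have "\<sigma> \<in> set (a # b # p) \<rightarrow> carrier R"
    using \<rho>(1) car cy(3) by (auto simp: \<sigma>_def spline_def)
  moreover have "last (b # p) \<noteq> a" using a last_in_set[of "b # p"] by (metis list.distinct(1))
  then have "\<sigma> (last (a # b # p)) = \<zero>" using \<rho>(3) by (simp add: \<sigma>_def)
  ultimately show ?case
    by (intro exI[of _ \<sigma>]) (auto simp: spline_def \<sigma>_def)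
qed simp

text \<open>Each path carries a spline with value \<open>x\<close> at \<open>u\<close> and zero at
  \<open>w\<close>. The paths share no other vertices, so the two splines fit together, and every
  edge of \<open>G\<close> lies on one of the paths.\<close>

lemma UDP_at_two_paths:
  assumes \<alpha>: "edge_labeling R G \<alpha>"
    and p: "p \<in> paths G u w" and q: "q \<in> paths G u w" and pq: "set p \<inter> set q \<subseteq> {u, w}"
    and V: "verts G \<subseteq> set p \<union> set q"
    and E: "edges G \<subseteq> set (path_edges p) \<union> set (path_edges q)"
  shows "UDP_at R G \<alpha> u w"
  unfolding UDP_at_def
proof
  fix x assume x: "x \<in> paths_inter R \<alpha> G u w"
  have ex: "\<exists>\<rho>. spline R \<lparr>verts = set l, edges = set (path_edges l)\<rparr> \<alpha> \<rho> \<and> \<rho> u = x \<and> \<rho> w = \<zero>"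
    if l: "l \<in> paths G u w" for l
  proof -
    have "l \<noteq> []" "distinct l" "hd l = u" "last l = w" "set (path_edges l) \<subseteq> edges G"
      using l by (simp_all add: paths_def)
    moreover have "x \<in> path_ideal R \<alpha> l" using x l by (simp add: paths_inter_def)
    ultimately show ?thesis
      using path_spline[of l \<alpha> x] \<alpha> unfolding edge_labeling_def by blast
  qed
  obtain \<rho> where \<rho>: "spline R \<lparr>verts = set p, edges = set (path_edges p)\<rparr> \<alpha> \<rho>" "\<rho> u = x" "\<rho> w = \<zero>"
    using ex[OF p] by blast
  obtain \<sigma> where \<sigma>: "spline R \<lparr>verts = set q, edges = set (path_edges q)\<rparr> \<alpha> \<sigma>" "\<sigma> u = x" "\<sigma> w = \<zero>"
    using ex[OF q] by blast
  define \<tau> where "\<tau> t = (if t \<in> set p then \<rho> t else \<sigma> t)" for t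
  have \<tau>p: "\<tau> t = \<rho> t" if "t \<in> set p" for t using that by (simp add: \<tau>_def)
  have \<tau>q: "\<tau> t = \<sigma> t" if "t \<in> set q" for t
    using that pq \<rho>(2,3) \<sigma>(2,3) by (auto simp: \<tau>_def)
  have "\<tau> a \<ominus> \<tau> b \<in> \<alpha> {a, b}" if ab: "{a, b} \<in> edges G" for a b
  proof (cases "{a, b} \<in> set (path_edges p)")
    case True
    then show ?thesis using path_edges_subset[OF True] \<tau>p \<rho>(1) by (simp add: spline_def)
  next
    case False
    then have q': "{a, b} \<in> set (path_edges q)" using E ab by blast
    then show ?thesis using path_edges_subset[OF q'] \<tau>q \<sigma>(1) by (simp add: spline_def)
  qed
  moreover have "\<tau> \<in> verts G \<rightarrow> carrier R"
    using V \<rho>(1) \<sigma>(1) by (fastforce simp: \<tau>_def spline_def)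
  ultimately have "spline R G \<alpha> \<tau>" by (simp add: spline_def)
  moreover have "u \<in> set p" "w \<in> set p" using p by (auto simp: paths_def)
  then have "\<tau> u \<ominus> \<tau> w = x" using \<tau>p \<rho>(2,3) x by (simp add: paths_inter_def a_minus_def)
  ultimately show "\<exists>\<tau>. spline R G \<alpha> \<tau> \<and> \<tau> u \<ominus> \<tau> w = x" by blast
qed

text \<open>The trivial path has the zero ideal, so zero is the only difference to be
  realised.\<close>

lemma UDP_at_refl: "edge_labeling R G \<alpha> \<Longrightarrow> u \<in> verts G \<Longrightarrow> UDP_at R G \<alpha> u u"
proof -
  assume \<alpha>: "edge_labeling R G \<alpha>" and "u \<in> verts G"
  then have "[u] \<in> paths G u u" by (simp add: paths_def)
  then have "paths_inter R \<alpha> G u u \<subseteq> {\<zero>}" by (force simp: paths_inter_def path_ideal_eq)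
  then show ?thesis
    unfolding UDP_at_def using spline_zero[OF \<alpha>]
    by (intro ballI exI[of _ "\<lambda>_. \<zero>"]) (auto simp: a_minus_def)
qed

text \<open>The concatenation creates one joining edge; on a cycle this will be the closing edge
  from \<open>v n\<close> to \<open>v 1\<close>.\<close>

lemma path_edges_append_nonempty:
  "p \<noteq> [] \<Longrightarrow> q \<noteq> [] \<Longrightarrow> path_edges (p @ q) = path_edges p @ {last p, hd q} # path_edges q"
proof (induction p rule: induct_list012)
  case (2 a)
  then show ?case by (cases q) auto
qed auto

text \<open>The case \<open>a = b\<close>, a single vertex without edges, is included: it occurs for
  pieces of an arc that consist only of \<open>v n\<close> or only of \<open>v 1\<close>.\<close>

lemma path_edges_arc:
  "a \<le> b \<Longrightarrow> set (path_edges (map v [a..<Suc b])) = {{v k, v (k + 1)} | k. a \<le> k \<and> k < b}"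
proof (induction b rule: dec_induct)
  case (step b)
  have "path_edges (map v [a..<Suc (Suc b)]) = path_edges (map v [a..<Suc b] @ [v (Suc b)])"
    using step.hyps by simp
  also have "\<dots> = path_edges (map v [a..<Suc b]) @ [{v b, v (Suc b)}]"
    using step.hyps by (subst path_edges_append_nonempty) (auto simp: last_map)
  finally show ?case using step by (auto simp: less_Suc_eq)
qed auto

lemma cycle_simple_graph:
  assumes "cycle_graph C n v"
  shows "simple_graph C"
proof -
  have n: "n \<ge> 3" and inj: "inj_on v {1..n}" and V: "verts C = v ` {1..n}"
    and E: "edges C = {{v k, v (k + 1)} | k. 1 \<le> k \<and> k < n} \<union> {{v n, v 1}}"
    using assms by (simp_all add: cycle_graph_def)
  have ne: "v k \<noteq> v l" if "k \<in> {1..n}" "l \<in> {1..n}" "k \<noteq> l" for k l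
    using inj_onD[OF inj _ that(1,2)] that(3) by blast
  have "\<exists>a\<in>verts C. \<exists>b\<in>verts C. a \<noteq> b \<and> {v k, v l} = {a, b}"
    if "k \<in> {1..n}" "l \<in> {1..n}" "k \<noteq> l" for k l
    using ne[OF that] that V by blast
  note edge = this
  show ?thesis
    unfolding simple_graph_def
  proof
    fix e assume "e \<in> edges C"
    then consider k where "1 \<le> k" "k < n" "e = {v k, v (k + 1)}" | "e = {v n, v 1}"
      unfolding E by blast
    then show "\<exists>a\<in>verts C. \<exists>b\<in>verts C. a \<noteq> b \<and> e = {a, b}"
    proof cases
      case 1
      then show ?thesis using edge[of k "k + 1"] by simp
    next
      case 2
      then show ?thesis using edge[of n 1] n by simp
    qed
  qed
qed

text \<open>The two arcs between \<open>v a\<close> and \<open>v b\<close> cover the cycle and meet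
  only at their ends, as \<open>UDP_at_two_paths\<close> requires.\<close>

lemma UDP_at_cycle:
  assumes C: "cycle_graph C n v" and \<alpha>: "edge_labeling R C \<alpha>"
    and ab: "1 \<le> a" "a < b" "b \<le> n"
  shows "UDP_at R C \<alpha> (v a) (v b)"
proof -
  have n: "n \<ge> 3" and inj: "inj_on v {1..n}" and V: "verts C = v ` {1..n}"
    and E: "edges C = {{v k, v (k + 1)} | k. 1 \<le> k \<and> k < n} \<union> {{v n, v 1}}"
    using C by (simp_all add: cycle_graph_def)
  define p where "p = map v [a..<Suc b]"
  \<comment> \<open>The other arc climbs from \<open>v b\<close> to \<open>v n\<close>, crosses the
    closing edge and continues from \<open>v 1\<close> to \<open>v a\<close>. It runs from
    \<open>v b\<close> to \<open>v a\<close> and is reversed before use.\<close>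
  define q where "q = map v [b..<Suc n] @ map v [1..<Suc a]"
  have ep: "set (path_edges p) = {{v k, v (k + 1)} | k. a \<le> k \<and> k < b}"
    unfolding p_def using ab by (intro path_edges_arc) simp
  have "last (map v [b..<Suc n]) = v n" "hd (map v [1..<Suc a]) = v 1"
    using ab by (auto simp: last_map hd_map simp del: upt_Suc)
  then have "path_edges q = path_edges (map v [b..<Suc n]) @ {v n, v 1} # path_edges (map v [1..<Suc a])"
    unfolding q_def using ab by (subst path_edges_append_nonempty) (auto simp del: upt_Suc)
  then have eq: "set (path_edges q) = {{v k, v (k + 1)} | k. b \<le> k \<and> k < n} \<union>
      {{v n, v 1}} \<union> {{v k, v (k + 1)} | k. 1 \<le> k \<and> k < a}"
    using path_edges_arc[of b n v] path_edges_arc[of 1 a v] ab by auto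
  have sp: "set p = v ` {a..b}" unfolding p_def by (auto simp del: upt_Suc)
  have sq: "set q = v ` ({b..n} \<union> {1..a})" unfolding q_def by (auto simp del: upt_Suc)
  have "distinct p"
    unfolding p_def distinct_map using ab inj by (auto simp del: upt_Suc intro: inj_on_subset)
  \<comment> \<open>Written as one mapped list of indices, so that distinctness follows from
    injectivity of \<open>v\<close>.\<close>
  have q_map: "q = map v ([b..<Suc n] @ [1..<Suc a])" by (simp add: q_def)
  have "distinct q"
    unfolding q_map distinct_map using ab inj
    by (auto simp del: upt_Suc intro: inj_on_subset)
  have hp: "p \<noteq> []" "hd p = v a" "last p = v b"
    unfolding p_def using ab by (auto simp: hd_map last_map simp del: upt_Suc)
  have hq: "q \<noteq> []" "hd q = v b" "last q = v a"
    unfolding q_def using ab by (auto simp: hd_append last_append hd_map last_map simp del: upt_Suc)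
  have "p \<in> paths C (v a) (v b)"
    unfolding paths_def using hp \<open>distinct p\<close> ab by (auto simp: sp V ep E)
  moreover have "q \<in> paths C (v b) (v a)"
    unfolding paths_def using hq \<open>distinct q\<close> ab by (auto simp: sq V eq E)
  then have "rev q \<in> paths C (v a) (v b)" by (rule paths_rev)
  moreover have "set p \<inter> set (rev q) \<subseteq> {v a, v b}"
  proof -
    have "v ` {a..b} \<inter> v ` ({b..n} \<union> {1..a}) = v ` ({a..b} \<inter> ({b..n} \<union> {1..a}))"
      using ab by (intro inj_on_image_Int[OF inj, symmetric]) auto
    also have "{a..b} \<inter> ({b..n} \<union> {1..a}) = {a, b}" using ab by auto
    finally show ?thesis by (simp add: sp sq)
  qed
  moreover have "verts C \<subseteq> set p \<union> set (rev q)"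
    unfolding V by (auto simp: sp sq intro!: imageI)
  moreover have "edges C \<subseteq> set (path_edges p) \<union> set (path_edges (rev q))"
  proof
    fix e assume "e \<in> edges C"
    then consider k where "1 \<le> k" "k < n" "e = {v k, v (k + 1)}" | "e = {v n, v 1}"
      unfolding E by blast
    then show "e \<in> set (path_edges p) \<union> set (path_edges (rev q))"
    proof cases
      case 1
      then consider "k < a" | "a \<le> k" "k < b" | "b \<le> k" by linarith
      then show ?thesis unfolding path_edges_rev set_rev ep eq using 1 by cases blast+
    qed (simp add: path_edges_rev eq)
  qed
  ultimately show ?thesis by (intro UDP_at_two_paths[OF \<alpha>])
qed

lemma UDP_cycle:
  assumes C: "cycle_graph C n v" and \<alpha>: "edge_labeling R C \<alpha>"
  shows "UDP R C \<alpha>"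
proof -
  have "UDP_at R C \<alpha> (v a) (v b)" if ab: "a \<in> {1..n}" "b \<in> {1..n}" for a b
  proof -
    have V: "v a \<in> verts C" "v b \<in> verts C" using C ab by (auto simp: cycle_graph_def)
    consider "a < b" | "a = b" | "b < a" by linarith
    then show ?thesis
    proof cases
      case 1
      then show ?thesis using UDP_at_cycle[OF C \<alpha>] ab by simp
    next
      case 2
      then show ?thesis using UDP_at_refl[OF \<alpha>] V by simp
    next
      case 3
      then have "UDP_at R C \<alpha> (v b) (v a)" using UDP_at_cycle[OF C \<alpha>] ab by simp
      then show ?thesis using UDP_at_commute[OF \<alpha>] V by blast
    qed
  qed
  then show ?thesis using C by (auto simp: UDP_iff cycle_graph_def)
qed

end

section \<open>A cycle with two trees pasted on\<close>

theorem theorem2p7: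
  fixes R :: "('a, 'b) ring_scheme" (structure)
    and C Ti Tj G1 G2 :: "'v ugraph"
    and \<alpha>C \<alpha>i \<alpha>j \<alpha> :: "'v set \<Rightarrow> 'a set"
    and v :: "nat \<Rightarrow> 'v"
    and n i j :: nat
  assumes "cring R"
    and "cycle_graph C n v" and "edge_labeling R C \<alpha>C"
    and "1 \<le> i" and "i < j" and "j \<le> n"
    and "tree_graph Ti" and "edge_labeling R Ti \<alpha>i"
    and "tree_graph Tj" and "edge_labeling R Tj \<alpha>j"
    and "pasting C Ti (v i) G1"
    and "pasting G1 Tj (v j) G2"
    and "\<forall>e \<in> edges C. \<alpha> e = \<alpha>C e"
    and "\<forall>e \<in> edges Ti. \<alpha> e = \<alpha>i e"
    and "\<forall>e \<in> edges Tj. \<alpha> e = \<alpha>j e"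
  shows "((\<forall>u \<in> verts C. \<forall>w \<in> verts Ti.
            paths_inter R \<alpha> G1 u w =
              paths_inter R \<alpha> C u (v i) <+>\<^bsub>R\<^esub> paths_inter R \<alpha> Ti (v i) w)
          \<and> (\<forall>r \<in> verts G1. \<forall>s \<in> verts Tj.
            paths_inter R \<alpha> G2 r s =
              paths_inter R \<alpha> G1 r (v j) <+>\<^bsub>R\<^esub> paths_inter R \<alpha> Tj (v j) s))
         \<longleftrightarrow> UDP R G2 \<alpha>"
    (is "?i \<and> ?ii \<longleftrightarrow> _")
proof -
  interpret cring R by fact
  have sC: "simple_graph C" using assms(2) by (rule cycle_simple_graph)
  have sT: "simple_graph Ti" "simple_graph Tj" using assms(7,9) by (simp_all add: tree_graph_def)
  have sG1: "simple_graph G1" using pasting_simple_graph assms(11) sC sT(1) by metis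
  \<comment> \<open>The common labeling \<open>\<alpha>\<close> agrees with the given labelings on
    the three pieces, so it replaces them from here on.\<close>
  have \<alpha>C: "edge_labeling R C \<alpha>" and \<alpha>i: "edge_labeling R Ti \<alpha>" and \<alpha>j: "edge_labeling R Tj \<alpha>"
    using assms(3,8,10,13-15) by (simp_all add: edge_labeling_def)
  have \<alpha>1: "edge_labeling R G1 \<alpha>"
    using assms(11) \<alpha>C \<alpha>i by (auto simp: edge_labeling_def pasting_def graph_union_def)
  have \<alpha>2: "edge_labeling R G2 \<alpha>"
    using assms(12) \<alpha>1 \<alpha>j by (auto simp: edge_labeling_def pasting_def graph_union_def)
  have i: "UDP R G1 \<alpha> \<longleftrightarrow> ?i"
    using UDP_pasting_iff[OF assms(11) sC sT(1) \<alpha>1 UDP_cycle[OF assms(2) \<alpha>C] UDP_tree[OF assms(7) \<alpha>i]] .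
  \<comment> \<open>The criterion for the second pasting presupposes the UDP of \<open>G1\<close>.
    This comes from (i) in one direction and from the UDP of \<open>G2\<close> by restriction in the
    other.\<close>
  have ii: "UDP R G2 \<alpha> \<longleftrightarrow> ?ii" if "UDP R G1 \<alpha>"
    using UDP_pasting_iff[OF assms(12) sG1 sT(2) \<alpha>2 that UDP_tree[OF assms(9) \<alpha>j]] .
  have "UDP R G2 \<alpha> \<Longrightarrow> UDP R G1 \<alpha>"
    using UDP_pasting_left[OF assms(12) sG1 sT(2) \<alpha>2] .
  then show ?thesis using i ii by blast
qed

end
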